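(* Let $n=2^s$ with $s\geq 2$, and let $h(z)=\sum_{0\leq i\leq n-1}a_iz^i\in\mathbb{F}_2[z]/(z^n-1)$ with $a_0=1$. Then $h(z)=g(z)g^*(z)$ for some $g(z)=\sum_{0\leq i\leq n-1}b_iz^i\in\mathbb{F}_2[z]/(z^n-1)$ if and only if $h(z)\in H$, where $H$ is the set of all $\sum_{0\leq i\leq n-1}a_iz^i\in\mathbb{F}_2[z]/(z^n-1)$ such that $$\sum_{0\leq i\leq n/2-1,\ i\text{ odd}}a_i=0,\qquad a_0=1,\quad a_{n/2}=0,\qquad a_i=a_{n-i}\ \text{for all } 1\leq i\leq n/2-1.$$ Furthermore, every $h(z)\in H$ has a unique factorization $h(z)=g(z)g^*(z)$ with $g(z)\in G$ (that is, there is exactly one such $g(z)\in G$), where $G$ is the set of all $\sum_{0\leq i\leq n-1}b_iz^i\in\mathbb{F}_2[z]/(z^n-1)$ such that $$b_0=1,\quad b_{n-1}=0,\qquad b_2=b_{n-3}=0,\qquad b_i=b_{n-1-i}\ \text{for all } 1\leq i\leq n/2-1 \text{ with } i\neq 2.$$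
   Context: Elements of $\mathbb{F}_2[z]/(z^n-1)$ are represented by their unique representatives of degree at most $n-1$, and products and equalities are in this ring. For $g(z)=\sum_{0\leq i\leq n-1}b_iz^i\in\mathbb{F}_2[z]/(z^n-1)$, the reciprocal polynomial is $g^*(z)=\sum_{0\leq i\leq n-1}b_iz^{n-i}\pmod{z^n-1}$. *)

theory Defs
  imports "HOL-Library.Z2" "HOL-Computational_Algebra.Polynomial"
begin

text \<open>
  The field with two elements is the library type \<^typ>\<open>bit\<close>. An element of
  \<open>F\<^sub>2[z]/(z\<^sup>n - 1)\<close>, where \<open>n > 0\<close>, is its unique representative of degree less than \<open>n\<close>.
\<close>

definition cyc_modulus :: "nat \<Rightarrow> bit poly" where
  "cyc_modulus n = monom 1 n - 1"

definition cyc_carrier :: "nat \<Rightarrow> bit poly set" where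
  "cyc_carrier n = {g. degree g \<le> n - 1}"

definition cyc_mult :: "nat \<Rightarrow> bit poly \<Rightarrow> bit poly \<Rightarrow> bit poly" where
  "cyc_mult n g h = (g * h) mod cyc_modulus n"

text \<open>The term for \<open>i = 0\<close> is \<open>b\<^sub>0 z\<^sup>n\<close>, which the reduction turns into \<open>b\<^sub>0\<close>. This is not the
  library's \<open>reflect_poly\<close>, which reverses relative to the degree of the polynomial.\<close>

definition reciprocal :: "nat \<Rightarrow> bit poly \<Rightarrow> bit poly" where
  "reciprocal n g = (\<Sum>i = 0..n - 1. monom (coeff g i) (n - i)) mod cyc_modulus n"

definition H_set :: "nat \<Rightarrow> bit poly set" where
  "H_set n = {h \<in> cyc_carrier n.
     (\<Sum>i | i \<le> n div 2 - 1 \<and> odd i. coeff h i) = 0 \<and>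
     coeff h 0 = 1 \<and>
     coeff h (n div 2) = 0 \<and>
     (\<forall>i. 1 \<le> i \<and> i \<le> n div 2 - 1 \<longrightarrow> coeff h i = coeff h (n - i))}"

definition G_set :: "nat \<Rightarrow> bit poly set" where
  "G_set n = {g \<in> cyc_carrier n.
     coeff g 0 = 1 \<and> coeff g (n - 1) = 0 \<and>
     coeff g 2 = 0 \<and> coeff g (n - 3) = 0 \<and>
     (\<forall>i. 1 \<le> i \<and> i \<le> n div 2 - 1 \<and> i \<noteq> 2 \<longrightarrow> coeff g i = coeff g (n - 1 - i))}"

end

theory Submission
  imports Defs
begin

text \<open>
  Let \<open>A\<^sub>k = \<Sum>\<^sub>j b\<^sub>j b\<^sub>j\<^sub>+\<^sub>k\<close> be the aperiodic autocorrelations of \<open>g\<close>. The coefficients of \<open>g g\<^sup>*\<close> are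
  \<open>A\<^sub>k + A\<^sub>n\<^sub>-\<^sub>k\<close>, which is symmetric and vanishes at \<open>k = n/2\<close>; the sum of the odd ones below \<open>n/2\<close> is the
  product of the even and the odd part of \<open>g(1)\<close>, which is \<open>0\<close> when \<open>g(1) = 1\<close>.

  For \<open>g \<in> G\<close> one has \<open>g\<^sup>* = 1 + z (g - 1)\<close>, so if \<open>g\<close> and \<open>g'\<close> in \<open>G\<close> have the same image and
  \<open>r = g - g'\<close>, then \<open>r (x + z r) = 0\<close> with \<open>x = z + 1\<close> and \<open>z\<^sup>n - 1 = x\<^sup>n\<close>. Comparing
  multiplicities of \<open>x\<close>, either \<open>r\<close> or \<open>x + z r\<close> is a multiple of \<open>x\<^sup>n\<^sup>-\<^sup>1\<close>; the conditions
  \<open>r\<^sub>0 = r\<^sub>2 = 0\<close> then leave only \<open>r = 0\<close>. Thus \<open>g \<mapsto> g g\<^sup>*\<close> embeds \<open>G\<close> into \<open>H\<close>, and it is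
  onto because \<open>H\<close> is not larger than \<open>G\<close>.
\<close>

text \<open>These rules turn field arithmetic on \<^typ>\<open>bit\<close> into Boolean operations.\<close>

declare add_bit_eq_xor [simp del] mult_bit_eq_and [simp del]

section \<open>Characteristic two\<close>

lemma bit_add_self [simp]: "x + x = (0 :: bit)"
  by (cases x) simp_all

lemma bit_add_left_self [simp]: "x + (x + y) = (y :: bit)"
  by (simp add: add.assoc[symmetric])

lemma bit_mult_self [simp]: "x * x = (x :: bit)"
  by (cases x) simp_all

lemma bit_poly_add_self [simp]: "p + p = (0 :: bit poly)"
  by (rule poly_eqI) (simp only: coeff_add coeff_0 bit_add_self)

lemma bit_poly_2 [simp]: "(2 :: bit poly) = 0"
  by (simp only: one_add_one[symmetric] bit_poly_add_self)

lemma bit_poly_minus_eq_add: "p - q = p + (q :: bit poly)"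
  by (rule poly_eqI) simp

lemma bit_poly_square_add: "(p + q)\<^sup>2 = p\<^sup>2 + (q :: bit poly)\<^sup>2"
proof -
  have "(p + q)\<^sup>2 = p\<^sup>2 + q\<^sup>2 + (p * q + p * q)"
    by (simp only: power2_eq_square algebra_simps)
  then show ?thesis by (simp only: bit_poly_add_self add_0_right)
qed

text \<open>Squaring is additive in characteristic two, so each doubling of the exponent squares
  both sides.\<close>

lemma cyc_modulus_eq_power: "cyc_modulus (2 ^ s) = [:1, 1:] ^ (2 ^ s)"
proof (induction s)
  case 0
  show ?case by (simp add: cyc_modulus_def monom_Suc bit_poly_minus_eq_add one_pCons)
next
  case (Suc s)
  have "cyc_modulus (2 ^ Suc s) = (cyc_modulus (2 ^ s))\<^sup>2"
    by (simp add: cyc_modulus_def bit_poly_minus_eq_add bit_poly_square_add monom_power mult.commute)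
  with Suc show ?case by (simp add: power_mult[symmetric] mult.commute)
qed

section \<open>Reduction modulo \<open>z^n - 1\<close>\<close>

lemma coeff_cyc_modulus_mult:
  "coeff (cyc_modulus n * q) k = (if k < n then 0 else coeff q (k - n)) + coeff q k"
  by (simp add: cyc_modulus_def bit_poly_minus_eq_add distrib_right coeff_monom_mult)

lemma degree_cyc_modulus: "n > 0 \<Longrightarrow> degree (cyc_modulus n) = n"
  by (simp add: cyc_modulus_def bit_poly_minus_eq_add degree_add_eq_left degree_monom_eq)

lemma coeff_cyc_carrier: "g \<in> cyc_carrier n \<Longrightarrow> n > 0 \<Longrightarrow> n \<le> i \<Longrightarrow> coeff g i = 0"
  by (auto simp: cyc_carrier_def intro!: coeff_eq_0)

lemma cyc_carrierI: "(\<And>i. i \<ge> n \<Longrightarrow> coeff g i = 0) \<Longrightarrow> n > 0 \<Longrightarrow> g \<in> cyc_carrier n"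
  by (auto simp: cyc_carrier_def intro!: degree_le)

lemma mod_cyc_modulus_in_carrier: "n > 0 \<Longrightarrow> p mod cyc_modulus n \<in> cyc_carrier n"
  using degree_mod_less'[of "cyc_modulus n" p] degree_cyc_modulus[of n]
  by (cases "cyc_modulus n = 0"; cases "p mod cyc_modulus n = 0") (auto simp: cyc_carrier_def)

text \<open>Below degree \<open>2 * n\<close> the quotient \<open>d\<close> has degree less than
  \<open>n\<close>, so reduction folds the upper half of the coefficients once onto the lower
  half.\<close>

lemma coeff_mod_cyc_modulus:
  assumes "n > 0" "degree p < 2 * n" "k < n"
  shows "coeff (p mod cyc_modulus n) k = coeff p k + coeff p (k + n)"
proof -
  define d where "d = p div cyc_modulus n"
  define q where "q = p mod cyc_modulus n"
  have p: "p = cyc_modulus n * d + q"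
    by (simp add: d_def q_def)
  have q: "q \<in> cyc_carrier n"
    unfolding q_def by (rule mod_cyc_modulus_in_carrier) fact
  have "degree (cyc_modulus n * d) < 2 * n"
    using q assms degree_diff_less[of p "2 * n" q] p by (auto simp: cyc_carrier_def)
  then have "coeff d (k + n) = 0"
    using assms degree_cyc_modulus[of n] degree_mult_eq[of "cyc_modulus n" d]
    by (cases "d = 0"; cases "cyc_modulus n = 0") (auto intro!: coeff_eq_0)
  moreover have "coeff q (k + n) = 0"
    using coeff_cyc_carrier[OF q] assms by simp
  ultimately have "coeff p k + coeff p (k + n) = coeff d k + coeff d k + coeff q k"
    using assms by (subst (1 2) p) (simp add: coeff_cyc_modulus_mult add_ac)
  then show ?thesis by (simp add: q_def)
qed

section \<open>Reciprocals and autocorrelations\<close>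

text \<open>Left unreduced: \<open>b_0\<close> stays at \<open>z^n\<close>, so one index rule
  \<open>n - j\<close> covers all positions from 1 to \<open>n\<close>.\<close>

definition recip_poly :: "nat \<Rightarrow> bit poly \<Rightarrow> bit poly" where
  "recip_poly n g = (\<Sum>i = 0..n - 1. monom (coeff g i) (n - i))"

lemma coeff_recip_poly:
  assumes "n > 0"
  shows "coeff (recip_poly n g) j = (if 1 \<le> j \<and> j \<le> n then coeff g (n - j) else 0)"
proof -
  have "coeff (recip_poly n g) j = (\<Sum>i = 0..n - 1. if n - i = j then coeff g i else 0)"
    by (simp add: recip_poly_def coeff_sum)
  also have "\<dots> = (\<Sum>i = 0..n - 1. if i = n - j then (if 1 \<le> j \<and> j \<le> n then coeff g i else 0) else 0)"
    using assms by (intro sum.cong) auto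
  also have "\<dots> = (if 1 \<le> j \<and> j \<le> n then coeff g (n - j) else 0)"
    by (subst sum.delta) auto
  finally show ?thesis .
qed

definition cyc_norm :: "nat \<Rightarrow> bit poly \<Rightarrow> bit poly" where
  "cyc_norm n g = cyc_mult n g (reciprocal n g)"

lemma cyc_norm_eq: "cyc_norm n g = (g * recip_poly n g) mod cyc_modulus n"
  by (simp add: cyc_norm_def cyc_mult_def reciprocal_def recip_poly_def mod_mult_right_eq)

lemma cyc_norm_in_carrier: "n > 0 \<Longrightarrow> cyc_norm n g \<in> cyc_carrier n"
  by (simp add: cyc_norm_eq mod_cyc_modulus_in_carrier)

definition autocorr :: "nat \<Rightarrow> bit poly \<Rightarrow> nat \<Rightarrow> bit" where
  "autocorr n g k = (\<Sum>j < n - k. coeff g j * coeff g (j + k))"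

text \<open>In the unreduced product, position \<open>k\<close> carries the autocorrelation at shift
  \<open>n - k\<close> and position \<open>k + n\<close> the one at shift \<open>k\<close>;
  reduction adds them.\<close>

lemma coeff_cyc_norm:
  assumes n: "n > 0" and g: "g \<in> cyc_carrier n" and k: "k < n"
  shows "coeff (cyc_norm n g) k = autocorr n g k + autocorr n g (n - k)"
proof -
  have "degree g \<le> n - 1" using g by (simp add: cyc_carrier_def)
  moreover have "degree (recip_poly n g) \<le> n"
    using n by (intro degree_le) (simp add: coeff_recip_poly)
  ultimately have "degree (g * recip_poly n g) < 2 * n"
    using n degree_mult_le[of g "recip_poly n g"] by linarith
  then have "coeff (cyc_norm n g) k =
      coeff (g * recip_poly n g) k + coeff (g * recip_poly n g) (k + n)"
    using n k by (simp add: cyc_norm_eq coeff_mod_cyc_modulus)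
  moreover have "coeff (g * recip_poly n g) k = autocorr n g (n - k)"
  proof -
    have "coeff (g * recip_poly n g) k = (\<Sum>i\<le>k. coeff g i * coeff (recip_poly n g) (k - i))"
      by (simp add: coeff_mult)
    also have "\<dots> = (\<Sum>i<k. coeff g i * coeff g (i + (n - k)))"
      using n k by (intro sum.mono_neutral_cong_right) (auto simp: coeff_recip_poly intro!: arg_cong[where f = "coeff g"])
    finally show ?thesis using k by (simp add: autocorr_def)
  qed
  moreover have "coeff (g * recip_poly n g) (k + n) = autocorr n g k"
  proof -
    have "coeff (g * recip_poly n g) (k + n) =
        (\<Sum>i\<le>k + n. coeff g i * coeff (recip_poly n g) (k + n - i))"
      by (simp add: coeff_mult)
    also have "\<dots> = (\<Sum>i\<in>{k..<n}. coeff g i * coeff g (i - k))"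
    proof (intro sum.mono_neutral_cong_right ballI)
      fix i assume "i \<in> {..k + n} - {k..<n}"
      then show "coeff g i * coeff (recip_poly n g) (k + n - i) = 0"
        using n coeff_cyc_carrier[OF g, of i] by (cases "i < k") (auto simp: coeff_recip_poly)
    next
      fix i assume "i \<in> {k..<n}"
      moreover from this have "n - (k + n - i) = i - k" by auto
      ultimately show "coeff g i * coeff (recip_poly n g) (k + n - i) = coeff g i * coeff g (i - k)"
        using n by (auto simp: coeff_recip_poly)
    qed auto
    also have "\<dots> = autocorr n g k"
      unfolding autocorr_def
      by (rule sum.reindex_bij_witness[of _ "\<lambda>j. j + k" "\<lambda>i. i - k"]) (auto simp: mult.commute)
    finally show ?thesis .
  qed
  ultimately show ?thesis by (simp add: add.commute)
qed

text \<open>The autocorrelation at shift \<open>n\<close> is an empty sum, and every element of the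
  field equals its square.\<close>

lemma coeff_cyc_norm_0:
  assumes "n > 0" "g \<in> cyc_carrier n"
  shows "coeff (cyc_norm n g) 0 = (\<Sum>i<n. coeff g i)"
  using assms by (simp add: coeff_cyc_norm autocorr_def)

text \<open>An odd shift joins an even and an odd index, and each such pair occurs exactly once, at
  the shift given by their distance.\<close>

lemma sum_odd_autocorr:
  "(\<Sum>k | k < n \<and> odd k. autocorr n g k) =
     (\<Sum>i | i < n \<and> even i. coeff g i) * (\<Sum>i | i < n \<and> odd i. coeff g i)"
proof -
  have "(\<Sum>k | k < n \<and> odd k. autocorr n g k) =
      (\<Sum>(k, j)\<in>(SIGMA k:{k. k < n \<and> odd k}. {..<n - k}). coeff g j * coeff g (j + k))"
    by (simp add: autocorr_def sum.Sigma)
  also have "\<dots> = (\<Sum>(e, d)\<in>{i. i < n \<and> even i} \<times> {i. i < n \<and> odd i}. coeff g e * coeff g d)"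
    by (rule sum.reindex_bij_witness[of _
          "\<lambda>(e, d). if e < d then (d - e, e) else (e - d, d)"
          "\<lambda>(k, j). if even j then (j, j + k) else (j + k, j)"])
       (auto split: if_splits simp: mult.commute)
  finally show ?thesis
    by (simp add: sum_product sum.cartesian_product)
qed

section \<open>Products \<open>g g*\<close> with \<open>g(1) = 1\<close> lie in
  \<open>H\<close>\<close>

lemma cyc_norm_in_H_set:
  assumes n: "4 dvd n" "n > 0" and g: "g \<in> cyc_carrier n" and one: "(\<Sum>i<n. coeff g i) = 1"
  shows "cyc_norm n g \<in> H_set n"
proof -
  obtain m where m: "n = 4 * m" using n(1) by blast
  have "m > 0" using m n by simp
  let ?h = "cyc_norm n g" and ?A = "autocorr n g"
  have sum0: "(\<Sum>i | i \<le> n div 2 - 1 \<and> odd i. coeff ?h i) = 0"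
  proof -
    have "(\<Sum>i | i \<le> n div 2 - 1 \<and> odd i. coeff ?h i) =
        (\<Sum>i | i < 2 * m \<and> odd i. ?A i + ?A (n - i))"
      using m \<open>m > 0\<close> n g by (intro sum.cong) (auto simp: coeff_cyc_norm)
    also have "\<dots> = (\<Sum>i | i < 2 * m \<and> odd i. ?A i) + (\<Sum>i | i < 2 * m \<and> odd i. ?A (n - i))"
      by (rule sum.distrib)
    also have "(\<Sum>i | i < 2 * m \<and> odd i. ?A (n - i)) = (\<Sum>i | 2 * m < i \<and> i < n \<and> odd i. ?A i)"
      using m by (intro sum.reindex_bij_witness[of _ "\<lambda>i. n - i" "\<lambda>i. n - i"]) (auto dest: odd_pos)
    also have "(\<Sum>i | i < 2 * m \<and> odd i. ?A i) + (\<Sum>i | 2 * m < i \<and> i < n \<and> odd i. ?A i) =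
        (\<Sum>i\<in>{i. i < 2 * m \<and> odd i} \<union> {i. 2 * m < i \<and> i < n \<and> odd i}. ?A i)"
      by (rule sum.union_disjoint[symmetric]) auto
    \<comment> \<open>The middle index \<open>2 * m\<close> is even, so no odd index is lost between
      the two ranges.\<close>
    also have "{i. i < 2 * m \<and> odd i} \<union> {i. 2 * m < i \<and> i < n \<and> odd i} = {i. i < n \<and> odd i}"
      using m by (auto simp: nat_neq_iff) presburger
    also have "(\<Sum>i\<in>\<dots>. ?A i) =
        (\<Sum>i | i < n \<and> even i. coeff g i) * (\<Sum>i | i < n \<and> odd i. coeff g i)"
      by (rule sum_odd_autocorr)
    also have "\<dots> = 0"
    proof -
      \<comment> \<open>Two elements of the field with sum 1 have product 0.\<close>
      have "(\<Sum>i | i < n \<and> even i. coeff g i) + (\<Sum>i | i < n \<and> odd i. coeff g i) =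
          (\<Sum>i\<in>{i. i < n \<and> even i} \<union> {i. i < n \<and> odd i}. coeff g i)"
        by (rule sum.union_disjoint[symmetric]) auto
      also have "{i. i < n \<and> even i} \<union> {i. i < n \<and> odd i} = {..<n}" by auto
      also note one
      finally show ?thesis
        by (cases "\<Sum>i | i < n \<and> even i. coeff g i") simp_all
    qed
    finally show ?thesis .
  qed
  show ?thesis
    unfolding H_set_def
  proof (intro CollectI conjI allI impI)
    show "coeff ?h 0 = 1" using n g one by (simp add: coeff_cyc_norm_0)
    show "coeff ?h (n div 2) = 0" using n g m by (simp add: coeff_cyc_norm)
    fix i assume "1 \<le> i \<and> i \<le> n div 2 - 1"
    then have "i < n" "n - i < n" "n - (n - i) = i" using n by auto
    then show "coeff ?h i = coeff ?h (n - i)"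
      using n g by (simp add: coeff_cyc_norm add.commute)
  qed (use sum0 n g in \<open>simp_all add: cyc_norm_in_carrier\<close>)
qed

section \<open>Symmetry of the polynomials in \<open>G\<close>\<close>

text \<open>Paired by \<open>i\<close> and \<open>n - 1 - i\<close>, equal coefficients cancel; only
  the pair of 0 and \<open>n - 1\<close> contributes, namely 1.\<close>

lemma sum_coeff_G_set:
  assumes "even n" "n > 0" and g: "g \<in> G_set n"
  shows "(\<Sum>i<n. coeff g i) = 1"
proof -
  obtain m where m: "n = 2 * m" using \<open>even n\<close> by blast
  have "(\<Sum>i<n. coeff g i) = (\<Sum>i\<in>{..<m} \<union> {m..<n}. coeff g i)"
    using m by (intro sum.cong) auto
  also have "\<dots> = (\<Sum>i<m. coeff g i) + (\<Sum>i\<in>{m..<n}. coeff g i)"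
    by (rule sum.union_disjoint) auto
  also have "(\<Sum>i\<in>{m..<n}. coeff g i) = (\<Sum>i<m. coeff g (n - 1 - i))"
    using m by (intro sum.reindex_bij_witness[of _ "\<lambda>i. n - 1 - i" "\<lambda>i. n - 1 - i"]) auto
  also have "(\<Sum>i<m. coeff g i) + \<dots> = (\<Sum>i<m. coeff g i + coeff g (n - 1 - i))"
    by (rule sum.distrib[symmetric])
  also have "\<dots> = (\<Sum>i<m. if i = 0 then 1 else 0)"
  proof (rule sum.cong)
    fix i assume "i \<in> {..<m}"
    then have i: "i < m" by simp
    consider "i = 0" | "i = 2" | "1 \<le> i" "i \<noteq> 2" by linarith
    then show "coeff g i + coeff g (n - 1 - i) = (if i = 0 then 1 else 0)"
    proof cases
      case 2
      then have "n - 1 - i = n - 3" by simp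
      with 2 g show ?thesis by (simp add: G_set_def)
    next
      case 3
      then have "coeff g i = coeff g (n - 1 - i)" using i m g by (simp add: G_set_def)
      with 3 show ?thesis by simp
    qed (use g in \<open>simp add: G_set_def\<close>)
  qed simp
  also have "\<dots> = 1" using m \<open>n > 0\<close> by simp
  finally show ?thesis .
qed

lemma recip_poly_G_set:
  assumes "even n" "n \<ge> 4" and g: "g \<in> G_set n"
  shows "recip_poly n g = monom 1 n + [:0, 1:] * (g - 1)"
proof (rule poly_eqI)
  fix j
  have carrier: "g \<in> cyc_carrier n" using g by (simp add: G_set_def)
  obtain m where m: "n = 2 * m" using \<open>even n\<close> by blast
  \<comment> \<open>The symmetry defining \<open>G\<close> extends to all inner positions: the upper
    half by reflection, and 2 and \<open>n - 3\<close> because both coefficients vanish.\<close>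
  have pal: "coeff g i = coeff g (n - 1 - i)" if "1 \<le> i" "i \<le> n - 2" for i
  proof -
    consider "i = 2" | "i = n - 3" | "i < m" "i \<noteq> 2" | "m \<le> i" "i \<noteq> n - 3" by linarith
    then show ?thesis
    proof cases
      case 1
      then have "n - 1 - i = n - 3" by simp
      with 1 g show ?thesis by (simp add: G_set_def)
    next
      case 2
      then have "n - 1 - i = 2" using assms by simp
      with 2 g show ?thesis by (simp add: G_set_def)
    next
      case 3
      then show ?thesis using that m g by (simp add: G_set_def)
    next
      case 4
      then have "1 \<le> n - 1 - i" "n - 1 - i \<le> n div 2 - 1" "n - 1 - i \<noteq> 2" "n - 1 - (n - 1 - i) = i"
        using that m assms by auto
      then show ?thesis using g by (fastforce simp: G_set_def)
    qed
  qed
  have g0: "coeff g 0 = 1" "coeff g (n - 1) = 0" using g by (simp_all add: G_set_def)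
  consider "j = 0" | "j = 1" | "2 \<le> j" "j \<le> n - 1" | "j = n" | "j > n" by linarith
  then show "coeff (recip_poly n g) j = coeff (monom 1 n + [:0, 1:] * (g - 1)) j"
  proof cases
    case 3
    then have "coeff g (j - 1) = coeff g (n - j)"
      using pal[of "j - 1"] by simp
    with 3 assms show ?thesis by (cases j) (auto simp: coeff_recip_poly coeff_pCons)
  qed (use assms g0 coeff_cyc_carrier[OF carrier, of "j - 1"] in
      \<open>auto simp: coeff_recip_poly coeff_pCons split: nat.splits\<close>)
qed

section \<open>Injectivity on \<open>G\<close>\<close>

text \<open>Multiplicities of the root \<open>a\<close> add up, and \<open>p\<close> contributes
  none.\<close>

lemma linear_power_dvd_mult_cancel:
  fixes p q :: "'a :: idom poly"
  assumes "[:-a, 1:] ^ k dvd p * q" "poly p a \<noteq> 0"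
  shows "[:-a, 1:] ^ k dvd q"
proof (cases "q = 0")
  case False
  moreover have "p \<noteq> 0" using assms(2) by auto
  ultimately show ?thesis
    using assms order_mult[of p q a] order_0I[of p a] by (simp add: order_divides)
qed simp

lemma eq_0_if_cyc_modulus_dvd:
  assumes n: "n = 2 ^ s" "n \<ge> 4" and r: "r \<in> cyc_carrier n" "coeff r 0 = 0" "coeff r 2 = 0"
    and dvd: "cyc_modulus n dvd r * ([:1, 1:] + [:0, 1:] * r)"
  shows "r = 0"
proof -
  let ?x = "[:1, 1:] :: bit poly"
  have M: "cyc_modulus n = ?x ^ n" unfolding n(1) by (rule cyc_modulus_eq_power)
  have M2: "cyc_modulus n = ?x\<^sup>2 * ?x ^ (n - 2)"
    unfolding M power_add[symmetric] by (rule arg_cong[where f = "(^) ?x"]) (use n(2) in linarith)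
  have deg_r: "degree r \<le> n - 1" using r by (simp add: cyc_carrier_def)
  have deg_M: "degree (cyc_modulus n) = n" using n by (simp add: degree_cyc_modulus)
  have "?x dvd r * (?x + [:0, 1:] * r)"
    using n(2) by (intro dvd_trans[OF _ dvd[unfolded M]] dvd_power) simp
  \<comment> \<open>At 1, \<open>x\<close> vanishes and \<open>z\<close> is 1, so the product takes
    the value \<open>r(1)^2\<close>.\<close>
  then have "?x dvd r" by (cases "poly r 1") (simp_all add: dvd_iff_poly_eq_0)
  then obtain w where w: "r = ?x * w" by blast
  have "?x\<^sup>2 * ?x ^ (n - 2) dvd ?x\<^sup>2 * (w * (1 + [:0, 1:] * w))"
    using dvd unfolding M2 w by (simp only: power2_eq_square algebra_simps mult_1_left mult_1_right)
  then have dvd_w: "?x ^ (n - 2) dvd w * (1 + [:0, 1:] * w)"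
    by (subst (asm) dvd_mult_cancel_left) simp
  show ?thesis
  \<comment> \<open>Exactly one of \<open>w\<close> and \<open>1 + z w\<close> vanishes at 1, and
    that factor absorbs the whole power of \<open>x\<close>.\<close>
  proof (cases "poly w 1 = 0")
    case True
    then have "?x ^ (n - 2) dvd w"
      using linear_power_dvd_mult_cancel[of 1 "n - 2" "1 + [:0, 1:] * w" w] dvd_w
      by (simp add: mult.commute)
    then obtain q where q: "w = ?x ^ (n - 2) * q" by blast
    \<comment> \<open>One more factor \<open>x\<close> completes the modulus; by degrees
      \<open>q\<close> is then constant, and its value is the constant term of \<open>x r\<close>,
      which is 0.\<close>
    have eq: "?x * r = cyc_modulus n * q"
      unfolding w q M2 by (simp only: power2_eq_square ac_simps)
    have "coeff (?x * r) 0 = 0" using r by simp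
    then have q0: "coeff q 0 = 0" using n(2) unfolding eq by (simp add: coeff_cyc_modulus_mult)
    have "q = 0"
    proof (rule ccontr)
      assume "q \<noteq> 0"
      then have "degree (?x * r) = n + degree q"
        unfolding eq using deg_M n(2) by (subst degree_mult_eq) auto
      moreover have "degree (?x * r) \<le> 1 + degree r"
        using degree_mult_le[of ?x r] by simp
      ultimately have "degree q = 0" using deg_r n(2) by simp
      with q0 \<open>q \<noteq> 0\<close> show False by (auto elim: degree_eq_zeroE)
    qed
    then show ?thesis by (simp add: w q)
  next
    case False
    then have "?x ^ (n - 2) dvd 1 + [:0, 1:] * w"
      using linear_power_dvd_mult_cancel[of 1 "n - 2" w "1 + [:0, 1:] * w"] dvd_w by simp
    then obtain q where q: "1 + [:0, 1:] * w = ?x ^ (n - 2) * q" by blast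
    have "?x * (?x + [:0, 1:] * r) = ?x\<^sup>2 * (1 + [:0, 1:] * w)"
      unfolding w by (simp only: power2_eq_square algebra_simps mult_1_left mult_1_right)
    then have eq: "?x * (?x + [:0, 1:] * r) = cyc_modulus n * q"
      unfolding q M2 by (simp only: ac_simps)
    \<comment> \<open>As \<open>n\<close> is at least 4, the term \<open>z^n q\<close> does not
      reach positions below 4.\<close>
    have coeffs: "coeff (?x * (?x + [:0, 1:] * r)) k = coeff q k" if "k < 4" for k
      using that n(2) unfolding eq by (simp add: coeff_cyc_modulus_mult)
    have q0: "coeff q 0 = 1" using coeffs[of 0] by simp
    then have "q \<noteq> 0" by auto
    then have "n + degree q = degree (?x * (?x + [:0, 1:] * r))"
      unfolding eq using deg_M n(2) by (subst degree_mult_eq) auto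
    also have "\<dots> \<le> degree ?x + degree (?x + [:0, 1:] * r)" by (rule degree_mult_le)
    also have "degree (?x + [:0, 1:] * r) \<le> n"
    proof (rule degree_add_le)
      have "degree ([:0, 1:] * r) \<le> degree [:0, 1 :: bit:] + degree r" by (rule degree_mult_le)
      also have "\<dots> \<le> n" using deg_r n(2) by simp
      finally show "degree ([:0, 1:] * r) \<le> n" .
    qed (use n(2) in simp)
    also have "degree ?x = 1" by simp
    \<comment> \<open>The degree bound leaves \<open>q\<close> at most linear, whereas its
      coefficients at 2 and 3 are \<open>1 + r_1\<close> and \<open>r_1\<close>, which cannot both
      vanish.\<close>
    finally have "coeff q 2 = 0" "coeff q 3 = 0" by (simp_all add: coeff_eq_0)
    moreover have "coeff q 2 = 1 + coeff r 1"
      using coeffs[of 2] r by (simp add: add.commute numeral_2_eq_2 numeral_3_eq_3 coeff_pCons)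
    moreover have "coeff q 3 = coeff r 1"
      using coeffs[of 3] r by (simp add: numeral_2_eq_2 numeral_3_eq_3 coeff_pCons)
    ultimately show ?thesis by simp
  qed
qed

lemma inj_on_cyc_norm_G_set:
  assumes n: "n = 2 ^ s" "n \<ge> 4"
  shows "inj_on (cyc_norm n) (G_set n)"
proof (rule inj_onI)
  fix g g' assume g: "g \<in> G_set n" and g': "g' \<in> G_set n" and eq: "cyc_norm n g = cyc_norm n g'"
  have "even n" using n by (cases s) auto
  let ?z = "[:0, 1:] :: bit poly"
  have expand: "f * (m + z * (f - 1)) = (m - 1) * f + f * (1 + z * (f - 1))" for f m z :: "bit poly"
    by (simp add: algebra_simps)
  have R: "f * recip_poly n f = cyc_modulus n * f + f * (1 + ?z * (f - 1))" if "f \<in> G_set n" for f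
    unfolding recip_poly_G_set[OF \<open>even n\<close> n(2) that] cyc_modulus_def by (rule expand)
  have "cyc_modulus n dvd g * recip_poly n g - g' * recip_poly n g'"
    using eq by (simp only: cyc_norm_eq mod_eq_dvd_iff)
  also have "g * recip_poly n g - g' * recip_poly n g' =
      cyc_modulus n * (g - g') + (g - g') * (1 + ?z * (g + g' - 1))"
    unfolding R[OF g] R[OF g'] by (simp only: algebra_simps mult_1_left mult_1_right)
  \<comment> \<open>In characteristic two \<open>g + g'\<close> is \<open>g - g'\<close>, so the
    second factor depends on the difference alone.\<close>
  also have "1 + ?z * (g + g' - 1) = [:1, 1:] + ?z * (g - g')"
  proof -
    have "1 + ?z * (g + g' - 1) = (1 + ?z) + ?z * (g - g')"
      unfolding bit_poly_minus_eq_add by (simp only: algebra_simps mult_1_left mult_1_right)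
    also have "1 + ?z = [:1, 1:]" by (simp add: one_pCons)
    finally show ?thesis .
  qed
  finally have "cyc_modulus n dvd (g - g') * ([:1, 1:] + ?z * (g - g'))"
    by (simp only: dvd_add_right_iff[OF dvd_triv_left])
  moreover have "g - g' \<in> cyc_carrier n" "coeff (g - g') 0 = 0" "coeff (g - g') 2 = 0"
    using g g' by (auto simp: G_set_def cyc_carrier_def intro: degree_diff_le)
  ultimately have "g - g' = 0" using eq_0_if_cyc_modulus_dvd[OF n] by blast
  then show "g = g'" by simp
qed

section \<open>Comparing the sizes of \<open>H\<close> and \<open>G\<close>\<close>

lemma finite_cyc_carrier: "finite (cyc_carrier n)"
proof (rule finite_subset)
  show "cyc_carrier n \<subseteq> Poly ` {xs. set xs \<subseteq> UNIV \<and> length xs \<le> Suc (n - 1)}"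
  proof
    fix g assume "g \<in> cyc_carrier n"
    then have "length (coeffs g) \<le> Suc (n - 1)"
      by (cases "g = 0") (auto simp: cyc_carrier_def length_coeffs_degree)
    then show "g \<in> Poly ` {xs. set xs \<subseteq> UNIV \<and> length xs \<le> Suc (n - 1)}"
      by (intro image_eqI[of _ _ "coeffs g"]) auto
  qed
  have "(UNIV :: bit set) = {0, 1}"
    using bit.exhaust by auto
  then have "finite (UNIV :: bit set)" by (rule ssubst) simp
  then show "finite (Poly ` {xs :: bit list. set xs \<subseteq> UNIV \<and> length xs \<le> Suc (n - 1)})"
    by (intro finite_imageI finite_lists_length_le)
qed

text \<open>
  An element of \<open>H\<close> is determined by \<open>a\<^sub>i\<close> for \<open>2 \<le> i < n/2\<close>, since \<open>a\<^sub>1\<close> follows from the parity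
  condition. The position 2 is not free in \<open>G\<close> but 1 is, so \<open>a\<^sub>2\<close> is stored in \<open>b\<^sub>1\<close>. For \<open>n = 4\<close>
  the positions 1 and \<open>n - 3\<close> coincide, whence the order of the tests.
\<close>

definition H_to_G_coeff :: "nat \<Rightarrow> bit poly \<Rightarrow> nat \<Rightarrow> bit" where
  "H_to_G_coeff n h i =
     (if i = 0 then 1 else if i \<ge> n - 1 \<or> i = 2 \<or> i = n - 3 then 0
      else if i = 1 \<or> i = n - 2 then coeff h 2
      else if i < n div 2 then coeff h i else coeff h (n - 1 - i))"

definition H_to_G :: "nat \<Rightarrow> bit poly \<Rightarrow> bit poly" where
  "H_to_G n h = Poly (map (H_to_G_coeff n h) [0..<n])"

lemma coeff_H_to_G: "n > 1 \<Longrightarrow> coeff (H_to_G n h) i = H_to_G_coeff n h i"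
  by (auto simp: H_to_G_def nth_default_def H_to_G_coeff_def)

lemma H_to_G_in_G_set:
  assumes "even n" "n \<ge> 4"
  shows "H_to_G n h \<in> G_set n"
proof -
  obtain m where m: "n = 2 * m" using \<open>even n\<close> by blast
  have "H_to_G n h \<in> cyc_carrier n"
    using assms by (intro cyc_carrierI) (auto simp: coeff_H_to_G H_to_G_coeff_def)
  moreover have "H_to_G_coeff n h i = H_to_G_coeff n h (n - 1 - i)"
    if i: "1 \<le> i" "i \<le> n div 2 - 1" "i \<noteq> 2" for i
  proof -
    define j where "j = n - 1 - i"
    have j: "j \<noteq> 0" "j \<noteq> 1" "\<not> j \<ge> n - 1" "j \<noteq> n - 3" "\<not> j < n div 2" "n - 1 - j = i"
      and i': "i \<noteq> 0" "\<not> i \<ge> n - 1" "i \<noteq> n - 2" "i < n div 2"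
      using i m assms by (simp_all add: j_def)
    \<comment> \<open>Reflection carries each tested position to a tested one; the first equivalence
      is met only for \<open>n = 4\<close>.\<close>
    have eqs: "j = 2 \<longleftrightarrow> i = n - 3" "j = n - 2 \<longleftrightarrow> i = 1"
      using i m assms by (auto simp: j_def)
    have "H_to_G_coeff n h i = (if i = n - 3 then 0 else if i = 1 then coeff h 2 else coeff h i)"
      using i i' by (simp only: H_to_G_coeff_def if_False if_True simp_thms)
    also have "\<dots> = H_to_G_coeff n h j"
      using j eqs by (simp only: H_to_G_coeff_def if_False if_True simp_thms)
    finally show ?thesis by (simp only: j_def)
  qed
  moreover have "H_to_G_coeff n h 0 = 1" "H_to_G_coeff n h (n - 1) = 0" "H_to_G_coeff n h 2 = 0"
    "H_to_G_coeff n h (n - 3) = 0"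
    using assms by (simp_all add: H_to_G_coeff_def)
  ultimately show ?thesis
    using assms(2) by (simp add: G_set_def coeff_H_to_G)
qed

lemma inj_on_H_to_G:
  assumes n: "even n" "n \<ge> 4"
  shows "inj_on (H_to_G n) (H_set n)"
proof (rule inj_onI)
  fix h h' assume h: "h \<in> H_set n" and h': "h' \<in> H_set n" and eq: "H_to_G n h = H_to_G n h'"
  obtain m where m: "n = 2 * m" using \<open>even n\<close> by blast
  have "m \<ge> 2" using m n by simp
  have eqc: "H_to_G_coeff n h i = H_to_G_coeff n h' i" for i
    using arg_cong[OF eq, of "\<lambda>p. coeff p i"] n(2) by (simp add: coeff_H_to_G)
  have rest: "coeff h i = coeff h' i" if i: "i < m" "i \<noteq> 1" for i
  proof -
    consider "i = 0" | "i = 2" | "i \<ge> 3" using i by linarith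
    then show ?thesis
    proof cases
      case 1
      then show ?thesis using h h' by (simp add: H_set_def)
    next
      case 2
      \<comment> \<open>Here \<open>2 < m\<close>, so \<open>n\<close> is at least 6 and position 1,
        which stores \<open>a_2\<close>, is not overwritten by the zero at
        \<open>n - 3\<close>.\<close>
      then have "\<not> 1 \<ge> n - 1" "(1 :: nat) \<noteq> n - 3"
        using i m by linarith+
      then show ?thesis using eqc[of 1] 2 by (simp add: H_to_G_coeff_def)
    next
      case 3
      then have "i \<noteq> 0" "\<not> i \<ge> n - 1" "i \<noteq> 2" "i \<noteq> n - 3" "i \<noteq> 1" "i \<noteq> n - 2" "i < n div 2"
        using i m by linarith+
      then show ?thesis using eqc[of i] by (simp only: H_to_G_coeff_def if_False if_True simp_thms)
    qed
  qed
  let ?S = "{i. i \<le> n div 2 - 1 \<and> odd i}"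
  have S: "finite ?S" "1 \<in> ?S" using m \<open>m \<ge> 2\<close> by auto
  have "(\<Sum>i\<in>?S - {1}. coeff h i) = (\<Sum>i\<in>?S - {1}. coeff h' i)"
    using m \<open>m \<ge> 2\<close> by (intro sum.cong rest) auto
  moreover have "sum (coeff h) ?S = sum (coeff h') ?S"
    using h h' by (simp add: H_set_def)
  ultimately have "coeff h 1 = coeff h' 1"
    unfolding sum.remove[OF S] by simp
  with rest have low: "coeff h i = coeff h' i" if "i < m" for i
    using that by metis
  show "h = h'"
  proof (rule poly_eqI)
    fix i
    consider "i < m" | "i = m" | "m < i" "i < n" | "i \<ge> n" by linarith
    then show "coeff h i = coeff h' i"
    proof cases
      case 1
      then show ?thesis by (rule low)
    next
      case 2
      then show ?thesis using h h' m by (simp add: H_set_def)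
    next
      case 3
      then have i: "1 \<le> n - i" "n - i \<le> n div 2 - 1" "n - (n - i) = i" "n - i < m"
        using m by auto
      have "coeff f i = coeff f (n - i)" if "f \<in> H_set n" for f
        using that i by (simp add: H_set_def)
      then show ?thesis using h h' low[OF i(4)] by simp
    next
      case 4
      then have "coeff f i = 0" if "f \<in> H_set n" for f
        using that n(2) by (intro coeff_cyc_carrier[of f n]) (simp_all add: H_set_def)
      then show ?thesis using h h' by simp
    qed
  qed
qed

section \<open>The bijection and the factorization theorem\<close>

lemma bij_betw_cyc_norm:
  assumes n: "n = 2 ^ s" "n \<ge> 4"
  shows "bij_betw (cyc_norm n) (G_set n) (H_set n)"
proof -
  have "s \<ge> 2" using n by (cases s; cases "s - 1") auto
  then have "4 dvd n" using n le_imp_power_dvd[of 2 s "2 :: nat"] by simp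
  then have "even n" by (rule dvd_trans[rotated]) simp
  have fin: "finite (G_set n)" "finite (H_set n)"
    using finite_cyc_carrier[of n] by (auto simp: G_set_def H_set_def)
  have inj: "inj_on (cyc_norm n) (G_set n)"
    using n by (rule inj_on_cyc_norm_G_set)
  have sub: "cyc_norm n ` G_set n \<subseteq> H_set n"
  proof
    fix h assume "h \<in> cyc_norm n ` G_set n"
    then obtain g where g: "g \<in> G_set n" "h = cyc_norm n g" by blast
    with n \<open>4 dvd n\<close> \<open>even n\<close> show "h \<in> H_set n"
      by (auto intro!: cyc_norm_in_H_set sum_coeff_G_set simp: G_set_def)
  qed
  have "card (H_set n) \<le> card (G_set n)"
    using inj_on_H_to_G[OF \<open>even n\<close> n(2)] H_to_G_in_G_set[OF \<open>even n\<close> n(2)] fin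
    by (intro card_inj_on_le[of "H_to_G n"]) auto
  \<comment> \<open>The image has as many elements as \<open>G\<close>, hence at least as many as
    the finite set \<open>H\<close> containing it.\<close>
  then have "cyc_norm n ` G_set n = H_set n"
    using fin sub by (intro card_seteq) (simp_all add: card_image[OF inj])
  with inj show ?thesis by (simp add: bij_betw_def)
qed

theorem theorem3p2:
  fixes n s :: nat
  assumes "s \<ge> 2" and "n = 2 ^ s"
  shows "(\<forall>h \<in> cyc_carrier n. coeff h 0 = 1 \<longrightarrow>
            ((\<exists>g \<in> cyc_carrier n. h = cyc_mult n g (reciprocal n g)) \<longleftrightarrow> h \<in> H_set n)) \<and>
         (\<forall>h \<in> H_set n. \<exists>!g. g \<in> G_set n \<and> h = cyc_mult n g (reciprocal n g))"
proof -
  have dvd: "4 dvd n" using assms le_imp_power_dvd[of 2 s "2 :: nat"] by simp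
  have pos: "n > 0" using assms by simp
  with dvd have "n \<ge> 4" by (auto dest: dvd_imp_le)
  with assms have bij: "bij_betw (cyc_norm n) (G_set n) (H_set n)"
    by (intro bij_betw_cyc_norm)
  have ex1: "\<exists>!g. g \<in> G_set n \<and> h = cyc_norm n g" if "h \<in> H_set n" for h
    using bij that unfolding bij_betw_def inj_on_def by blast
  have "(\<exists>g \<in> cyc_carrier n. h = cyc_norm n g) \<longleftrightarrow> h \<in> H_set n" if "coeff h 0 = 1" for h
  proof
    assume "\<exists>g \<in> cyc_carrier n. h = cyc_norm n g"
    \<comment> \<open>The constant coefficient of the product is \<open>g(1)\<close>, so
      \<open>a_0 = 1\<close> supplies the condition on \<open>g\<close>.\<close>
    then show "h \<in> H_set n"
      using that dvd pos by (auto intro!: cyc_norm_in_H_set simp: coeff_cyc_norm_0)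
  next
    assume "h \<in> H_set n"
    then show "\<exists>g \<in> cyc_carrier n. h = cyc_norm n g"
      using ex1[of h] by (auto simp: G_set_def)
  qed
  with ex1 show ?thesis by (simp add: cyc_norm_def)
qed

end
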